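(* Let $n\geq 4$, let $\langle A\mid R\rangle$ be any monoid presentation for the symmetric group $S_n$, and let $\langle A,\zeta,\eta\mid R,S\rangle$ be a monoid presentation for the partial transformation monoid $PT_n$, where $\zeta$ represents the idempotent full transformation of rank $n-1$ with $(2)\zeta=1$ and $\eta$ represents the idempotent partial permutation of rank $n-1$ with $\operatorname{dom}(\eta)=\{2,\ldots,n\}$. Then there are at least four relations of rank $n-2$ in $S$.
   Context: Maps act on the right and are composed from left to right. $PT_n$ is the monoid of all partial maps from $\{1,\ldots,n\}$ to itself; its group of units is $S_n$; the rank of an element is the size of its image. A monoid presentation $\langle X\mid Q\rangle$ with $Q\subseteq X^*\times X^*$ defines the quotient of the free monoid $X^*$ by the least congruence $Q^{\sharp}$ containing $Q$; $\langle A,\zeta,\eta\mid R,S\rangle$ means $\langle A\cup\{\zeta,\eta\}\mid R\cup S\rangle$, with $\zeta,\eta\notin A$ distinct. The letters of $A$ represent permutations in $S_n$, and $\phi:(A\cup\{\zeta,\eta\})^*\to PT_n$ denotes the surjective homomorphism sending each letter to the element it represents; its kernel is the congruence generated by $R\cup S$, and its restriction to $A^*$ has image $S_n$ and kernel the congruence on $A^*$ generated by $R$. A word $w$ has rank $r$ if $(w)\phi$ has rank $r$; a relation $(u,v)$ has rank $r$ if $u$ (equivalently $v$) has rank $r$. *)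

theory Defs
  imports "HOL-Algebra.Group" "HOL-Combinatorics.Permutations"
begin

section \<open>Partial transformations\<close>

text \<open>Partial maps act on the right: the product \<open>f \<otimes> g\<close> is ``first \<open>f\<close>, then \<open>g\<close>''.\<close>

definition PT :: "nat \<Rightarrow> (nat \<rightharpoonup> nat) monoid" where
  "PT n = \<lparr>carrier = {f. dom f \<subseteq> {1..n} \<and> ran f \<subseteq> {1..n}},
           monoid.mult = (\<lambda>f g. g \<circ>\<^sub>m f),
           one = Some |` {1..n}\<rparr>"

definition Sym :: "nat \<Rightarrow> (nat \<rightharpoonup> nat) monoid" where
  "Sym n = (PT n)\<lparr>carrier := {(Some \<circ> p) |` {1..n} | p. p permutes {1..n}}\<rparr>"

definition rank :: "(nat \<rightharpoonup> nat) \<Rightarrow> nat" where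
  "rank f = card (ran f)"

lemma monoid_PT: "monoid (PT n)"
proof
  fix f g h assume f: "f \<in> carrier (PT n)" and g: "g \<in> carrier (PT n)" and "h \<in> carrier (PT n)"
  show "f \<otimes>\<^bsub>PT n\<^esub> g \<in> carrier (PT n)"
    using f g by (fastforce simp: PT_def map_comp_def dom_def ran_def split: option.splits)
  show "f \<otimes>\<^bsub>PT n\<^esub> g \<otimes>\<^bsub>PT n\<^esub> h = f \<otimes>\<^bsub>PT n\<^esub> (g \<otimes>\<^bsub>PT n\<^esub> h)"
    by (auto simp: PT_def map_comp_def fun_eq_iff split: option.splits)
next
  show "\<one>\<^bsub>PT n\<^esub> \<in> carrier (PT n)"
    by (auto simp: PT_def restrict_map_def ran_def split: if_splits)
next
  fix f assume f: "f \<in> carrier (PT n)"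
  have undef: "f x = None" if "x \<notin> {1..n}" for x
    using f that by (auto simp: PT_def dom_def)
  have in_ran: "y \<in> {1..n}" if "f x = Some y" for x y
    using f ranI[of f, OF that] by (auto simp: PT_def)
  show "\<one>\<^bsub>PT n\<^esub> \<otimes>\<^bsub>PT n\<^esub> f = f"
  proof
    fix x show "(\<one>\<^bsub>PT n\<^esub> \<otimes>\<^bsub>PT n\<^esub> f) x = f x"
      using undef[of x] by (cases "x \<in> {1..n}") (simp_all add: PT_def map_comp_def)
  qed
  show "f \<otimes>\<^bsub>PT n\<^esub> \<one>\<^bsub>PT n\<^esub> = f"
  proof
    fix x show "(f \<otimes>\<^bsub>PT n\<^esub> \<one>\<^bsub>PT n\<^esub>) x = f x"
      using in_ran[of x] by (cases "f x") (simp_all add: PT_def map_comp_def)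
  qed
qed

text \<open>\<open>Sym n\<close> is the group of units of \<open>PT n\<close>.\<close>

lemma Units_PT: "Units (PT n) = carrier (Sym n)"
proof (intro equalityI subsetI)
  fix f assume "f \<in> Units (PT n)"
  then obtain g where fd: "dom f \<subseteq> {1..n}" "ran f \<subseteq> {1..n}"
    and gf: "f \<circ>\<^sub>m g = Some |` {1..n}" and fg: "g \<circ>\<^sub>m f = Some |` {1..n}"
    by (auto simp: Units_def PT_def)
  have ex: "\<exists>y. f x = Some y \<and> g y = Some x" if "x \<in> {1..n}" for x
    using fun_cong[OF fg, of x] that by (auto simp: map_comp_def split: option.splits)
  define p where "p x = (if x \<in> {1..n} then the (f x) else x)" for x
  have "inj_on p {1..n}"
  proof (rule inj_onI)
    fix x y assume "x \<in> {1..n}" "y \<in> {1..n}" "p x = p y"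
    then show "x = y" using ex[of x] ex[of y] by (auto simp: p_def)
  qed
  moreover have sub: "p ` {1..n} \<subseteq> {1..n}"
  proof
    fix y assume "y \<in> p ` {1..n}"
    then obtain x where "x \<in> {1..n}" "y = p x" by blast
    with ex[of x] have "f x = Some y" by (auto simp: p_def)
    with fd(2) show "y \<in> {1..n}" by (auto simp: ran_def)
  qed
  ultimately have "bij_betw p {1..n} {1..n}"
    by (simp add: bij_betw_def endo_inj_surj)
  then have "p permutes {1..n}"
    by (rule bij_imp_permutes) (auto simp: p_def)
  moreover have "f = (Some \<circ> p) |` {1..n}"
  proof
    fix x show "f x = ((Some \<circ> p) |` {1..n}) x"
      using ex[of x] fd(1) by (cases "x \<in> {1..n}") (auto simp: p_def restrict_map_def dom_def)
  qed
  ultimately show "f \<in> carrier (Sym n)" by (auto simp: Sym_def)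
next
  have PTc: "(Some \<circ> p) |` {1..n} \<in> carrier (PT n)" if "p permutes {1..n}" for p
  proof -
    have "ran ((Some \<circ> p) |` {1..n}) \<subseteq> p ` {1..n}"
      by (auto simp: ran_def restrict_map_def split: if_splits)
    then show ?thesis
      unfolding permutes_image[OF that] by (simp add: PT_def)
  qed
  have comp: "((Some \<circ> q) |` {1..n}) \<circ>\<^sub>m ((Some \<circ> p) |` {1..n}) = Some |` {1..n}"
    if "p permutes {1..n}" "q \<circ> p = id" for p q
  proof
    fix x show "(((Some \<circ> q) |` {1..n}) \<circ>\<^sub>m ((Some \<circ> p) |` {1..n})) x = (Some |` {1..n}) x"
      using permutes_in_image[OF that(1), of x] fun_cong[OF that(2), of x]
      by (cases "x \<in> {1..n}") (simp_all add: map_comp_def)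
  qed
  fix f assume "f \<in> carrier (Sym n)"
  then obtain p where p: "p permutes {1..n}" and f: "f = (Some \<circ> p) |` {1..n}"
    by (auto simp: Sym_def)
  let ?g = "(Some \<circ> inv_into UNIV p) |` {1..n}"
  have "?g \<circ>\<^sub>m f = Some |` {1..n}"
    unfolding f by (rule comp[OF p permutes_inv_o(2)[OF p]])
  moreover have "f \<circ>\<^sub>m ?g = Some |` {1..n}"
    unfolding f by (rule comp[OF permutes_inv[OF p] permutes_inv_o(1)[OF p]])
  moreover have "f \<in> carrier (PT n)" "?g \<in> carrier (PT n)"
    using PTc[OF p] PTc[OF permutes_inv[OF p]] by (simp_all add: f)
  ultimately have "f \<in> carrier (PT n) \<and>
      (\<exists>g \<in> carrier (PT n). g \<otimes>\<^bsub>PT n\<^esub> f = \<one>\<^bsub>PT n\<^esub> \<and> f \<otimes>\<^bsub>PT n\<^esub> g = \<one>\<^bsub>PT n\<^esub>)"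
    by (intro conjI bexI[of _ ?g]) (simp_all add: PT_def)
  then show "f \<in> Units (PT n)"
    by (simp add: Units_def)
qed


section \<open>Monoid presentations\<close>

text \<open>The free monoid \<open>X\<^sup>*\<close> is \<open>lists X\<close> under concatenation.\<close>

definition word_congruence :: "'a set \<Rightarrow> 'a list rel \<Rightarrow> bool" where
  "word_congruence X C \<longleftrightarrow> equiv (lists X) C \<and>
     (\<forall>(u, v) \<in> C. \<forall>w \<in> lists X. (w @ u, w @ v) \<in> C \<and> (u @ w, v @ w) \<in> C)"

definition generated_congruence :: "'a set \<Rightarrow> 'a list rel \<Rightarrow> 'a list rel" where
  "generated_congruence X Q = \<Inter> {C. word_congruence X C \<and> Q \<subseteq> C}"

definition word_val :: "('m, 'b) monoid_scheme \<Rightarrow> ('a \<Rightarrow> 'm) \<Rightarrow> 'a list \<Rightarrow> 'm" where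
  "word_val M rep w = foldr (\<lambda>x m. rep x \<otimes>\<^bsub>M\<^esub> m) w \<one>\<^bsub>M\<^esub>"

text \<open>\<open>\<langle>X | Q\<rangle>\<close> is a presentation for \<open>M\<close> in which each letter \<open>x\<close> of \<open>X\<close> represents the
  element \<open>rep x\<close>.\<close>

definition presents ::
    "('m, 'b) monoid_scheme \<Rightarrow> ('a \<Rightarrow> 'm) \<Rightarrow> 'a set \<Rightarrow> 'a list rel \<Rightarrow> bool" where
  "presents M rep X Q \<longleftrightarrow>
     Q \<subseteq> lists X \<times> lists X \<and>
     rep ` X \<subseteq> carrier M \<and>
     word_val M rep ` lists X = carrier M \<and>
     {(u, v) \<in> lists X \<times> lists X. word_val M rep u = word_val M rep v}
       = generated_congruence X Q"

text \<open>If \<open>S\<close> is contained in the kernel of \<open>word_val (PT n) rep\<close>, as are the relations of any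
  presentation for \<open>PT n\<close>, both sides of a relation have the same rank.\<close>

definition relations_of_rank ::
    "nat \<Rightarrow> ('a \<Rightarrow> nat \<rightharpoonup> nat) \<Rightarrow> 'a list rel \<Rightarrow> nat \<Rightarrow> 'a list rel" where
  "relations_of_rank n rep S r = {(u, v) \<in> S. rank (word_val (PT n) rep u) = r}"

end

theory Submission
  imports Defs
begin

text \<open>
  Every non-unit word has a shortest non-unit prefix, whose value collapses two points of
  \<open>{1..n}\<close>, or one point with ``undefined''. Rewriting by relations of rank at least \<open>n - 1\<close>
  preserves the kernel of that prefix. The kernel of a map of rank \<open>n - 2\<close> has one of four shapes:
  three points identified, two disjoint pairs identified, one pair identified and one point
  undefined, or two points undefined. For each shape there are two words with the same value of that
  shape whose shortest non-unit prefixes have different kernels, and only a relation of rank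
  \<open>n - 2\<close> of the same shape can change that kernel. So each shape needs its own relation.
\<close>

section \<open>Kernels and shapes of partial maps\<close>

text \<open>Undefined points form a kernel class.\<close>

definition kern :: "(nat \<rightharpoonup> nat) \<Rightarrow> nat rel" where
  "kern f = {(i, j). f i = f j}"

text \<open>An invariant of the kernel that tells the four types of rank \<open>n - 2\<close> apart:
  the domain size separates all but the two total types, and the flag separates a class of three
  points from two classes of two.\<close>

definition shape :: "(nat \<rightharpoonup> nat) \<Rightarrow> nat \<times> bool" where
  "shape f = (card (dom f),
     \<exists>x y z. x \<noteq> y \<and> y \<noteq> z \<and> x \<noteq> z \<and> f x \<noteq> None \<and> f x = f y \<and> f y = f z)"

definition perm_map :: "nat \<Rightarrow> (nat \<Rightarrow> nat) \<Rightarrow> (nat \<rightharpoonup> nat)" where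
  "perm_map n p = (Some \<circ> p) |` {1..n}"

section \<open>Composition of partial maps: effect on rank and kernel\<close>

lemma mult_PT: "f \<otimes>\<^bsub>PT n\<^esub> g = g \<circ>\<^sub>m f"
  by (simp add: PT_def)

lemma carrier_PT: "f \<in> carrier (PT n) \<longleftrightarrow> dom f \<subseteq> {1..n} \<and> ran f \<subseteq> {1..n}"
  by (simp add: PT_def)

lemma finite_ran_PT: "f \<in> carrier (PT n) \<Longrightarrow> finite (ran f)"
  by (auto simp: carrier_PT intro: finite_subset)

text \<open>The domains matter where \<open>f\<close> is undefined at \<open>i\<close> but not at
  \<open>j\<close>: the composite then agrees at \<open>i\<close> and \<open>j\<close> exactly if
  the second map is undefined at \<open>f j\<close>.\<close>

lemma kern_map_comp_cong:
  assumes "dom g = dom h" "kern g = kern h"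
  shows "kern (g \<circ>\<^sub>m f) = kern (h \<circ>\<^sub>m f)"
proof -
  have "g i = g j \<longleftrightarrow> h i = h j" for i j
    using assms(2) by (auto simp: kern_def set_eq_iff)
  moreover have "g i = None \<longleftrightarrow> h i = None" for i
    using assms(1) by (metis domIff)
  ultimately have "(g \<circ>\<^sub>m f) i = (g \<circ>\<^sub>m f) j \<longleftrightarrow> (h \<circ>\<^sub>m f) i = (h \<circ>\<^sub>m f) j" for i j
    by (cases "f i"; cases "f j") (auto simp: map_comp_def eq_commute[of None])
  then show ?thesis by (simp add: kern_def)
qed

text \<open>The right side lives in the option type, so that \<open>None\<close> counts as a value
  of \<open>g\<close> on \<open>ran f\<close>. Equality then also says that \<open>g\<close> is
  defined on all of \<open>ran f\<close>.\<close>

lemma Some_ran_map_comp: "Some ` ran (g \<circ>\<^sub>m f) \<subseteq> g ` ran f"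
proof
  fix y assume "y \<in> Some ` ran (g \<circ>\<^sub>m f)"
  then obtain i z where "f i = Some z" "g z = y"
    by (auto simp: ran_def map_comp_def split: option.splits)
  then show "y \<in> g ` ran f" by (auto intro: ranI)
qed

lemma rank_map_comp_le1: "rank (g \<circ>\<^sub>m f) \<le> rank f" if "finite (ran f)"
proof -
  have "card (Some ` ran (g \<circ>\<^sub>m f)) \<le> card (g ` ran f)"
    using that by (intro card_mono Some_ran_map_comp) simp
  also have "\<dots> \<le> card (ran f)"
    using that by (rule card_image_le)
  finally show ?thesis by (simp add: rank_def card_image)
qed

lemma rank_map_comp_le2: "rank (g \<circ>\<^sub>m f) \<le> rank g" if "finite (ran g)"
  unfolding rank_def using that
  by (intro card_mono) (auto simp: ran_def map_comp_def split: option.splits)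

text \<open>If composing with \<open>g\<close> loses no rank, then \<open>g\<close> is defined and
  injective on \<open>ran f\<close>, so it neither merges kernel classes nor makes one
  undefined.\<close>

lemma kern_map_comp_eq:
  assumes "finite (ran f)" "rank f \<le> rank (g \<circ>\<^sub>m f)"
  shows "kern (g \<circ>\<^sub>m f) = kern f"
proof -
  have fin: "finite (g ` ran f)" using assms(1) by simp
  have le: "card (g ` ran f) \<le> card (ran f)" by (rule card_image_le[OF assms(1)])
  have ge: "card (ran f) \<le> card (Some ` ran (g \<circ>\<^sub>m f))"
    using assms(2) by (simp add: rank_def card_image)
  have eq: "Some ` ran (g \<circ>\<^sub>m f) = g ` ran f"
    by (rule card_seteq[OF fin Some_ran_map_comp]) (use le ge in linarith)
  then have "card (g ` ran f) = card (ran f)"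
    using le ge by simp
  then have inj: "inj_on g (ran f)" by (rule eq_card_imp_inj_on[OF assms(1)])
  have def: "g y \<noteq> None" if "f i = Some y" for i y
    using eq ranI[of f, OF that] by (metis imageE imageI option.distinct(1))
  have "(g \<circ>\<^sub>m f) i = (g \<circ>\<^sub>m f) j \<longleftrightarrow> f i = f j" for i j
    using def[of i] def[of j] inj_onD[OF inj] ranI[of f i] ranI[of f j]
    by (cases "f i"; cases "f j") (auto simp: map_comp_def)
  then show ?thesis by (simp add: kern_def)
qed

text \<open>The point 0 lies outside \<open>{1..n}\<close>, so both maps are undefined there, and
  the kernel class of 0 is the set of undefined points.\<close>

lemma kern_eq_imp_shape_eq:
  assumes f: "f \<in> carrier (PT n)" and g: "g \<in> carrier (PT n)" and k: "kern f = kern g"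
  shows "dom f = dom g" "shape f = shape g"
proof -
  have eq: "f i = f j \<longleftrightarrow> g i = g j" for i j
    using k by (auto simp: kern_def set_eq_iff)
  have "f 0 = None" "g 0 = None"
    using f g by (auto simp: carrier_PT)
  then have none: "f i = None \<longleftrightarrow> g i = None" for i
    using eq[of i 0] by simp
  then show "dom f = dom g" by (simp add: dom_def)
  then show "shape f = shape g"
    by (simp add: shape_def eq none)
qed

section \<open>Permutations as partial maps, and composition with them\<close>

lemma Sym_carrier: "carrier (Sym n) = {perm_map n p | p. p permutes {1..n}}"
  by (simp add: Sym_def perm_map_def)

text \<open>\<open>p\<close> fixes every point outside \<open>{1..n}\<close>, where \<open>f\<close>
  is undefined, so the restriction in \<open>perm_map\<close> makes no difference to the
  composite.\<close>

lemma mult_perm_map: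
  assumes "f \<in> carrier (PT n)" "p permutes {1..n}"
  shows "perm_map n p \<otimes>\<^bsub>PT n\<^esub> f = f \<circ> p"
proof
  fix i
  show "(perm_map n p \<otimes>\<^bsub>PT n\<^esub> f) i = (f \<circ> p) i"
  proof (cases "i \<in> {1..n}")
    case False
    with assms(1) have "f i = None" by (auto simp: carrier_PT)
    moreover have "p i = i" by (rule permutes_not_in[OF assms(2) False])
    ultimately show ?thesis using False by (simp add: mult_PT perm_map_def)
  qed (simp add: mult_PT perm_map_def)
qed

lemma ran_perm:
  assumes "p permutes S"
  shows "ran (f \<circ> p) = ran f"
proof -
  have "ran (f \<circ> p) = {y. \<exists>i \<in> range p. f i = Some y}" by (auto simp: ran_def)
  then show ?thesis by (simp add: permutes_surj[OF assms] ran_def)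
qed

text \<open>A bijection of the points carries domain and kernel classes over without changing their
  sizes.\<close>

lemma shape_perm:
  assumes "p permutes S"
  shows "shape (f \<circ> p) = shape f"
proof -
  have inj: "inj p" and surj: "surj p"
    using permutes_inj permutes_surj assms by blast+
  have ex3: "(\<exists>x y z. P (p x) (p y) (p z)) \<longleftrightarrow> (\<exists>x y z. P x y z)" for P
  proof
    assume "\<exists>x y z. P x y z"
    then obtain x y z where "P x y z" by blast
    moreover obtain x' y' z' where "x = p x'" "y = p y'" "z = p z'"
      using surj by (meson surjD)
    ultimately show "\<exists>x y z. P (p x) (p y) (p z)" by blast
  qed blast
  have "dom (f \<circ> p) = p -` dom f" by auto
  then have "card (dom (f \<circ> p)) = card (dom f)"
    using card_vimage_inj[OF inj, of "dom f"] surj by simp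
  moreover have "(\<exists>x y z. x \<noteq> y \<and> y \<noteq> z \<and> x \<noteq> z \<and> (f \<circ> p) x \<noteq> None \<and> (f \<circ> p) x = (f \<circ> p) y \<and> (f \<circ> p) y = (f \<circ> p) z)
    \<longleftrightarrow> (\<exists>x y z. x \<noteq> y \<and> y \<noteq> z \<and> x \<noteq> z \<and> f x \<noteq> None \<and> f x = f y \<and> f y = f z)"
    using ex3[of "\<lambda>x y z. x \<noteq> y \<and> y \<noteq> z \<and> x \<noteq> z \<and> f x \<noteq> None \<and> f x = f y \<and> f y = f z"]
    by (simp only: inj_eq[OF inj] o_apply)
  ultimately show ?thesis by (simp add: shape_def)
qed

lemma perm_map_PT: "perm_map n p \<in> carrier (PT n)" "ran (perm_map n p) = {1..n}"
  if "p permutes {1..n}"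
proof -
  have "ran (perm_map n p) = p ` {1..n}"
    by (auto simp: perm_map_def ran_def restrict_map_def split: if_splits)
  then show *: "ran (perm_map n p) = {1..n}"
    by (simp only: permutes_image[OF that])
  show "perm_map n p \<in> carrier (PT n)"
    using * by (simp add: carrier_PT) (simp add: perm_map_def)
qed

lemma rank_perm_map: "p permutes {1..n} \<Longrightarrow> rank (perm_map n p) = n"
  by (simp add: rank_def perm_map_PT)


section \<open>Words\<close>

lemma word_val_Sym: "word_val (Sym n) = word_val (PT n)"
  by (intro ext) (simp add: word_val_def Sym_def)

lemma word_val_closed:
  assumes "w \<in> lists X" "rep ` X \<subseteq> carrier (PT n)"
  shows "word_val (PT n) rep w \<in> carrier (PT n)"
  using assms by (induction w) (auto simp: word_val_def intro: monoid.m_closed[OF monoid_PT] monoid.one_closed[OF monoid_PT])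

lemma word_val_append:
  assumes "u \<in> lists X" "v \<in> lists X" "rep ` X \<subseteq> carrier (PT n)"
  shows "word_val (PT n) rep (u @ v) = word_val (PT n) rep u \<otimes>\<^bsub>PT n\<^esub> word_val (PT n) rep v"
  using assms(1)
proof (induction u)
  case Nil
  then show ?case
    using word_val_closed[OF assms(2,3)] by (simp add: word_val_def monoid.l_one[OF monoid_PT])
next
  case (Cons x u)
  then have "rep x \<in> carrier (PT n)" "u \<in> lists X" using assms(3) by auto
  then show ?case
    using Cons word_val_closed[OF _ assms(3), of u] word_val_closed[OF assms(2,3)]
    by (simp add: word_val_def monoid.m_assoc[OF monoid_PT])
qed

text \<open>The letters of \<open>A\<close> up to and including the first letter outside
  \<open>A\<close>. Thanks to \<open>take 1\<close>, a word over \<open>A\<close> is its own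
  \<open>first_nonunit\<close>.\<close>

definition first_nonunit :: "'a set \<Rightarrow> 'a list \<Rightarrow> 'a list" where
  "first_nonunit A w = takeWhile (\<lambda>x. x \<in> A) w @ take 1 (dropWhile (\<lambda>x. x \<in> A) w)"

lemma first_nonunit_append:
  "u \<in> lists A \<Longrightarrow> first_nonunit A (u @ v) = u @ first_nonunit A v"
  "u \<notin> lists A \<Longrightarrow> first_nonunit A (u @ v) = first_nonunit A u"
  by (induction u) (auto simp: first_nonunit_def)

lemma split_first_nonunit:
  assumes "w \<notin> lists A"
  obtains p x s where "w = p @ x # s" "first_nonunit A w = p @ [x]" "p \<in> lists A" "x \<notin> A"
proof -
  have "\<exists>x\<in>set w. x \<notin> A" using assms by auto
  then have ne: "dropWhile (\<lambda>x. x \<in> A) w \<noteq> []" by (simp add: dropWhile_eq_Nil_conv)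
  then obtain x s where xs: "dropWhile (\<lambda>x. x \<in> A) w = x # s" by (cases "dropWhile (\<lambda>x. x \<in> A) w") auto
  show thesis
  proof
    show "w = takeWhile (\<lambda>x. x \<in> A) w @ x # s" by (simp flip: xs)
    show "first_nonunit A w = takeWhile (\<lambda>x. x \<in> A) w @ [x]" by (simp add: first_nonunit_def xs)
    show "takeWhile (\<lambda>x. x \<in> A) w \<in> lists A" by (auto dest: set_takeWhileD)
    show "x \<notin> A" using hd_dropWhile[OF ne] by (simp add: xs)
  qed
qed


section \<open>Presentations extending one of the symmetric group\<close>

text \<open>\<open>B\<close> stands for the two extra letters. The bound on \<open>n\<close> keeps
  \<open>n - 2\<close>, \<open>n - 1\<close> and \<open>n\<close> distinct under truncated
  subtraction.\<close>

locale sym_extension =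
  fixes n :: nat and A B :: "'a set" and R S :: "'a list rel" and rep :: "'a \<Rightarrow> nat \<rightharpoonup> nat"
  assumes n: "2 \<le> n"
    and pres_Sym: "presents (Sym n) rep A R"
    and pres_PT: "presents (PT n) rep (A \<union> B) (R \<union> S)"
    and rank_B: "x \<in> B \<Longrightarrow> rank (rep x) < n"
begin

section \<open>Values of words and ranks of their prefixes\<close>

abbreviation "X \<equiv> A \<union> B"
abbreviation "val \<equiv> word_val (PT n) rep"

lemma rep_X: "rep ` X \<subseteq> carrier (PT n)"
  using pres_PT by (simp add: presents_def)

lemmas val_closed = word_val_closed[OF _ rep_X]
lemmas val_append = word_val_append[OF _ _ rep_X]

lemma val_image_A: "val ` lists A = {perm_map n p | p. p permutes {1..n}}"
  using pres_Sym by (simp add: presents_def word_val_Sym Sym_carrier)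

lemma val_A:
  assumes "w \<in> lists A"
  obtains p where "p permutes {1..n}" "val w = perm_map n p"
proof -
  have "val w \<in> {perm_map n p | p. p permutes {1..n}}"
    using imageI[OF assms, of val] by (simp only: val_image_A)
  then show thesis using that by blast
qed

lemma perm_word:
  assumes "p permutes {1..n}"
  obtains w where "w \<in> lists A" "val w = perm_map n p"
proof -
  have "perm_map n p \<in> val ` lists A"
    unfolding val_image_A using assms by blast
  then show thesis using that by (metis imageE)
qed

lemma val_surj:
  assumes "f \<in> carrier (PT n)"
  obtains w where "w \<in> lists X" "val w = f"
proof -
  have "f \<in> val ` lists X" using pres_PT assms by (simp add: presents_def)
  then show thesis using that by (metis imageE)
qed

text \<open>The last letter of the prefix lies in \<open>B\<close>, and the rank of a product is at
  most that of its last factor.\<close>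

lemma rank_first_nonunit:
  assumes "w \<in> lists X" "w \<notin> lists A"
  shows "rank (val (first_nonunit A w)) < n"
proof -
  obtain p x s where w: "w = p @ x # s" and fw: "first_nonunit A w = p @ [x]"
    and p: "p \<in> lists A" "x \<notin> A"
    by (rule split_first_nonunit[OF assms(2)])
  have x: "x \<in> B" "x \<in> X" using p assms(1) w by auto
  then have r: "rep x \<in> carrier (PT n)" using rep_X by auto
  have "p \<in> lists X" using p by auto
  then have "val (p @ [x]) = val [x] \<circ>\<^sub>m val p" using x by (simp add: val_append mult_PT)
  also have "val [x] = rep x" using r by (simp add: word_val_def monoid.r_one[OF monoid_PT])
  finally show ?thesis
    using rank_map_comp_le2[OF finite_ran_PT[OF r], of "val p"] rank_B[OF x(1)] fw by simp
qed

lemma val_prefix: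
  assumes "w \<in> lists X" "w \<notin> lists A"
  obtains s where "s \<circ>\<^sub>m val (first_nonunit A w) = val w"
    "first_nonunit A w \<in> lists X"
proof -
  obtain p x s where w: "w = p @ x # s" and fw: "first_nonunit A w = p @ [x]"
    by (rule split_first_nonunit[OF assms(2)])
  have X: "p @ [x] \<in> lists X" "s \<in> lists X" using assms(1) by (simp_all add: w)
  have "val w = val s \<circ>\<^sub>m val (p @ [x])"
    using val_append[OF X] by (simp add: w mult_PT)
  then show thesis
    by (intro that[of "val s"]) (use \<open>val w = _\<close> in \<open>simp_all only: fw X val_closed\<close>)
qed

lemma rank_lt_n:
  assumes "w \<in> lists X" "w \<notin> lists A"
  shows "rank (val w) < n"
proof -
  obtain s where "s \<circ>\<^sub>m val (first_nonunit A w) = val w" "first_nonunit A w \<in> lists X"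
    by (rule val_prefix[OF assms])
  then show ?thesis
    using rank_map_comp_le1[OF finite_ran_PT[OF val_closed], of "first_nonunit A w" s]
      rank_first_nonunit[OF assms] by simp
qed

text \<open>Hence lying over \<open>A\<close> depends on the value alone, and the two sides of a
  relation are either both over \<open>A\<close> or both not.\<close>

lemma in_A_iff:
  assumes "w \<in> lists X"
  shows "w \<in> lists A \<longleftrightarrow> rank (val w) = n"
proof
  assume "w \<in> lists A"
  then obtain p where "p permutes {1..n}" "val w = perm_map n p" by (rule val_A)
  then show "rank (val w) = n" by (simp add: rank_perm_map)
next
  assume r: "rank (val w) = n"
  show "w \<in> lists A"
  proof (rule ccontr)
    assume "w \<notin> lists A"
    from rank_lt_n[OF assms this] r show False by simp
  qed
qed

text \<open>The prefix has rank at most \<open>n - 1\<close> already, so the rest of the word loses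
  no rank. In rank \<open>n - 1\<close> the kernel of the prefix is thus determined by the
  value.\<close>

lemma kern_first_nonunit:
  assumes "w \<in> lists X" "rank (val w) = n - 1"
  shows "kern (val (first_nonunit A w)) = kern (val w)"
proof -
  have w: "w \<notin> lists A" using in_A_iff[OF assms(1)] assms(2) n by simp
  obtain s where s: "s \<circ>\<^sub>m val (first_nonunit A w) = val w" "first_nonunit A w \<in> lists X"
    by (rule val_prefix[OF assms(1) w])
  have "rank (val (first_nonunit A w)) \<le> rank (s \<circ>\<^sub>m val (first_nonunit A w))"
    unfolding s(1) using rank_first_nonunit[OF assms(1) w] assms(2) by simp
  from kern_map_comp_eq[OF finite_ran_PT[OF val_closed[OF s(2)]] this]
  show ?thesis unfolding s(1) by (rule sym)
qed

section \<open>A congruence for each shape\<close>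

text \<open>Words of equal value are related freely unless they have rank \<open>n - 2\<close> and
  shape \<open>t\<close>. A relation can therefore violate \<open>agree t\<close> only if it has
  that rank and shape.\<close>

definition agree :: "nat \<times> bool \<Rightarrow> 'a list rel" where
  "agree t = {(u, v) \<in> lists X \<times> lists X. val u = val v \<and>
     (rank (val u) = n - 2 \<and> shape (val u) = t \<longrightarrow>
       kern (val (first_nonunit A u)) = kern (val (first_nonunit A v)))}"

lemma first_nonunit_closed: "w \<in> lists X \<Longrightarrow> first_nonunit A w \<in> lists X"
proof -
  assume "w \<in> lists X"
  moreover have "w = first_nonunit A w @ drop 1 (dropWhile (\<lambda>x. x \<in> A) w)"
    by (simp only: first_nonunit_def append_assoc append_take_drop_id takeWhile_dropWhile_id)
  ultimately show ?thesis by (metis append_in_lists_conv)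
qed

text \<open>If \<open>w\<close> contains a letter outside \<open>A\<close>, both products have the
  same prefix. Otherwise \<open>w\<close> acts as a permutation, which preserves rank and shape and
  pulls both kernels back alike.\<close>

lemma agree_left:
  assumes uv: "(u, v) \<in> agree t" and w: "w \<in> lists X"
  shows "(w @ u, w @ v) \<in> agree t"
proof -
  have u: "u \<in> lists X" and v: "v \<in> lists X" and eq: "val u = val v"
    using uv by (auto simp: agree_def)
  have "kern (val (first_nonunit A (w @ u))) = kern (val (first_nonunit A (w @ v)))"
    if T: "rank (val (w @ u)) = n - 2" "shape (val (w @ u)) = t"
  proof (cases "w \<in> lists A")
    case True
    then obtain p where p: "p permutes {1..n}" "val w = perm_map n p" by (rule val_A)
    have "val (w @ u) = val u \<circ> p"
      using w u by (simp only: val_append p mult_perm_map[OF val_closed p(1)])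
    then have "rank (val u) = n - 2" "shape (val u) = t"
      using T by (simp_all add: rank_def ran_perm[OF p(1)] shape_perm[OF p(1)])
    then have k: "kern (val (first_nonunit A u)) = kern (val (first_nonunit A v))"
      using uv by (simp add: agree_def)
    then have d: "dom (val (first_nonunit A u)) = dom (val (first_nonunit A v))"
      by (rule kern_eq_imp_shape_eq(1)[of _ n, rotated 2])
        (use u v in \<open>simp_all add: val_closed first_nonunit_closed\<close>)
    show ?thesis
      using kern_map_comp_cong[OF d k] w u v True
      by (simp add: first_nonunit_append val_append mult_PT first_nonunit_closed)
  qed (simp add: first_nonunit_append)
  then show ?thesis
    using u v w eq by (simp add: agree_def val_append)
qed

text \<open>If \<open>u\<close> is not over \<open>A\<close>, its rank is \<open>n - 1\<close> or
  \<open>n - 2\<close>. In the first case the common value determines the kernel of the prefix; in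
  the second \<open>w\<close> loses no rank, so \<open>u\<close> already has shape \<open>t\<close>
  and the assumption on \<open>u\<close> and \<open>v\<close> applies.\<close>

lemma agree_right:
  assumes uv: "(u, v) \<in> agree t" and w: "w \<in> lists X"
  shows "(u @ w, v @ w) \<in> agree t"
proof -
  have u: "u \<in> lists X" and v: "v \<in> lists X" and eq: "val u = val v"
    using uv by (auto simp: agree_def)
  have A: "u \<in> lists A \<longleftrightarrow> v \<in> lists A"
    using in_A_iff[OF u] in_A_iff[OF v] eq by simp
  have "kern (val (first_nonunit A (u @ w))) = kern (val (first_nonunit A (v @ w)))"
    if T: "rank (val (u @ w)) = n - 2" "shape (val (u @ w)) = t"
  proof (cases "u \<in> lists A")
    case True
    with A show ?thesis
      using u v w eq by (simp add: first_nonunit_append val_append first_nonunit_closed)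
  next
    case False
    have uw: "val (u @ w) = val w \<circ>\<^sub>m val u"
      using u w by (simp add: val_append mult_PT)
    have fin: "finite (ran (val u))" using u by (rule finite_ran_PT[OF val_closed])
    have "n - 2 \<le> rank (val u)"
      using rank_map_comp_le1[OF fin, of "val w"] T(1) uw by simp
    with rank_lt_n[OF u False] consider "rank (val u) = n - 1" | "rank (val u) = n - 2"
      by linarith
    then have "kern (val (first_nonunit A u)) = kern (val (first_nonunit A v))"
    proof cases
      case 1
      then show ?thesis using kern_first_nonunit[OF u] kern_first_nonunit[OF v] eq by simp
    next
      case 2
      have "kern (val (u @ w)) = kern (val u)"
        unfolding uw by (rule kern_map_comp_eq[OF fin]) (use 2 T uw in simp)
      then have "shape (val u) = t"
        using kern_eq_imp_shape_eq(2)[of "val (u @ w)" n "val u"] T(2) u w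
        by (simp add: val_closed)
      with 2 uv show ?thesis by (simp add: agree_def)
    qed
    with False A show ?thesis by (simp add: first_nonunit_append)
  qed
  then show ?thesis
    using u v w eq by (simp add: agree_def val_append)
qed

lemma word_congruence_agree: "word_congruence X (agree t)"
proof -
  have "equiv (lists X) (agree t)"
    by (rule equivI) (auto simp: agree_def refl_on_def sym_def trans_def)
  then show ?thesis
    unfolding word_congruence_def by (auto intro: agree_left agree_right simp del: in_lists_conv_set)
qed

section \<open>Relations forced by two words of equal value\<close>

lemma relations_sound: "(u, v) \<in> R \<union> S \<Longrightarrow> u \<in> lists X \<and> v \<in> lists X \<and> val u = val v"
proof -
  assume uv: "(u, v) \<in> R \<union> S"
  have "(u, v) \<in> generated_congruence X (R \<union> S)"
    using uv by (auto simp: generated_congruence_def)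
  also have "\<dots> = {(u, v) \<in> lists X \<times> lists X. val u = val v}"
    using pres_PT by (simp add: presents_def)
  finally show ?thesis by auto
qed

text \<open>Without such a relation, \<open>agree\<close> for this shape would be a congruence
  containing \<open>R \<union> S\<close>, hence would contain every pair of words with equal values,
  among them \<open>(u, v)\<close>.\<close>

lemma relation_of_shape:
  assumes "u \<in> lists X" "v \<in> lists X" "val u = val v" "rank (val u) = n - 2"
    and ne: "kern (val (first_nonunit A u)) \<noteq> kern (val (first_nonunit A v))"
  shows "\<exists>(a, b) \<in> S. rank (val a) = n - 2 \<and> shape (val a) = shape (val u)"
proof (rule ccontr)
  assume no: "\<not> ?thesis"
  have "R \<union> S \<subseteq> agree (shape (val u))"
  proof (clarify)
    fix a b assume ab: "(a, b) \<in> R \<union> S"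
    \<comment> \<open>Relations in \<open>R\<close> have rank \<open>n\<close>, so one of rank
      \<open>n - 2\<close> must come from \<open>S\<close>.\<close>
    have "a \<in> lists A" if "(a, b) \<in> R" using pres_Sym that by (auto simp: presents_def)
    then have "\<not> (rank (val a) = n - 2 \<and> shape (val a) = shape (val u))"
      using ab no n in_A_iff[of a] relations_sound[OF ab] by fastforce
    then show "(a, b) \<in> agree (shape (val u))"
      using relations_sound[OF ab] unfolding agree_def by blast
  qed
  then have "generated_congruence X (R \<union> S) \<subseteq> agree (shape (val u))"
    using word_congruence_agree[of "shape (val u)"] unfolding generated_congruence_def by blast
  moreover have "(u, v) \<in> generated_congruence X (R \<union> S)"
    using pres_PT assms by (auto simp: presents_def)
  ultimately show False using assms by (auto simp: agree_def)
qed

text \<open>The word spells \<open>p\<close>, then \<open>x\<close>, then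
  \<open>f \<circ> p\<close>. By \<open>fixed\<close> the letter \<open>x\<close> is absorbed, and
  the two copies of the involution \<open>p\<close> cancel.\<close>

lemma word_through:
  assumes f: "f \<in> carrier (PT n)" and p: "p permutes {1..n}" "p \<circ> p = id"
    and x: "x \<in> B" and fixed: "(f \<circ> p) \<circ>\<^sub>m rep x = f \<circ> p"
  obtains w where "w \<in> lists X" "val w = f" "kern (val (first_nonunit A w)) = kern (rep x \<circ> p)"
proof -
  obtain u where u: "u \<in> lists A" "val u = perm_map n p" by (rule perm_word[OF p(1)])
  have "perm_map n p \<otimes>\<^bsub>PT n\<^esub> f \<in> carrier (PT n)"
    using f p by (intro monoid.m_closed[OF monoid_PT] perm_map_PT)
  then have fp: "f \<circ> p \<in> carrier (PT n)" by (simp only: mult_perm_map[OF f p(1)])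
  then obtain v where v: "v \<in> lists X" "val v = f \<circ> p" by (rule val_surj)
  have uX: "u \<in> lists X" and xX: "[x] \<in> lists X" using u x by auto
  have r: "rep x \<in> carrier (PT n)" using rep_X x by auto
  have vx: "val [x] = rep x" using r by (simp add: word_val_def monoid.r_one[OF monoid_PT])
  \<comment> \<open>Letters of \<open>A\<close> have rank \<open>n\<close>, those of
    \<open>B\<close> smaller rank.\<close>
  have notA: "x \<notin> A"
    using in_A_iff[OF xX] rank_B[OF x] vx by auto
  show thesis
  proof (rule that)
    show "u @ [x] @ v \<in> lists X" using uX xX v by simp
    have "val ([x] @ v) = f \<circ> p"
      by (subst val_append[OF xX v(1)]) (simp add: vx v mult_PT fixed)
    then have "val (u @ [x] @ v) = perm_map n p \<otimes>\<^bsub>PT n\<^esub> (f \<circ> p)"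
      using uX xX v by (subst val_append) (auto simp: u)
    also have "\<dots> = f \<circ> (p \<circ> p)" by (simp only: mult_perm_map[OF fp p(1)] comp_assoc)
    finally show "val (u @ [x] @ v) = f" by (simp add: p)
    have "first_nonunit A (u @ [x] @ v) = u @ [x]"
      using u notA by (simp add: first_nonunit_append) (simp add: first_nonunit_def)
    moreover have "val (u @ [x]) = rep x \<circ> p"
      by (subst val_append[OF uX xX]) (simp only: vx u mult_perm_map[OF r p(1)])
    ultimately show "kern (val (first_nonunit A (u @ [x] @ v))) = kern (rep x \<circ> p)" by simp
  qed
qed

text \<open>\<open>word_through\<close> is used twice, with the identity and \<open>x\<close> and
  with \<open>p\<close> and \<open>y\<close>, giving two words for \<open>f\<close> whose prefixes
  have different kernels.\<close>

lemma relation_of_two_factorizations: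
  assumes f: "f \<in> carrier (PT n)" "rank f = n - 2"
    and p: "p permutes {1..n}" "p \<circ> p = id"
    and x: "x \<in> B" "f \<circ>\<^sub>m rep x = f"
    and y: "y \<in> B" "(f \<circ> p) \<circ>\<^sub>m rep y = f \<circ> p"
    and ne: "kern (rep x) \<noteq> kern (rep y \<circ> p)"
  obtains a b where "(a, b) \<in> relations_of_rank n rep S (n - 2)" "shape (val a) = shape f"
proof -
  obtain u where u: "u \<in> lists X" "val u = f" "kern (val (first_nonunit A u)) = kern (rep x)"
    by (rule word_through[OF f(1) permutes_id _ x(1)]) (use x(2) in simp_all)
  obtain v where v: "v \<in> lists X" "val v = f" "kern (val (first_nonunit A v)) = kern (rep y \<circ> p)"
    by (rule word_through[OF f(1) p y])
  show thesis
    using relation_of_shape[OF u(1) v(1)] u v f ne that by (auto simp: relations_of_rank_def)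
qed

end


section \<open>The four shapes\<close>

lemma ran_idem_eqI:
  assumes "\<And>x y. f x = Some y \<Longrightarrow> y \<in> E" "\<And>y. y \<in> E \<Longrightarrow> f y = Some y"
  shows "ran f = E"
  using assms unfolding ran_def by blast

text \<open>An idempotent fixes its image pointwise. As 2 is moved, it is not in the image, and the
  rank forces the image to be everything else.\<close>

lemma zeta_eq:
  assumes "f \<in> carrier (PT n)" "f \<circ>\<^sub>m f = f" "dom f = {1..n}" "rank f = n - 1" "f 2 = Some 1"
    "2 \<le> n"
  shows "f = (\<lambda>i. if i = 2 then Some 1 else if i \<in> {1..n} then Some i else None)"
proof -
  have idem: "f j = Some j" if "f i = Some j" for i j
    using fun_cong[OF assms(2), of i] that by (simp add: map_comp_def)
  have "2 \<notin> ran f" using idem[of _ 2] assms(5) by (auto simp: ran_def)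
  then have "ran f \<subseteq> {1..n} - {2}" using assms(1) by (auto simp: carrier_PT)
  moreover have "card ({1..n} - {2}) \<le> card (ran f)"
    using assms(4,6) by (simp add: rank_def)
  ultimately have "ran f = {1..n} - {2}" by (intro card_seteq) auto
  then have "f i = Some i" if "i \<in> {1..n} - {2}" for i
    using idem that by (auto simp: ran_def set_eq_iff)
  moreover have "f i = None" if "i \<notin> {1..n}" for i using assms(3) that by auto
  ultimately show ?thesis using assms(5) by auto
qed

text \<open>If \<open>f\<close> sends \<open>i\<close> to \<open>j\<close>, idempotence makes it
  send \<open>j\<close> to \<open>j\<close> too, so injectivity gives \<open>i = j\<close>.\<close>

lemma eta_eq:
  assumes "f \<circ>\<^sub>m f = f" "inj_on f (dom f)"
  shows "f = Some |` dom f"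
proof
  fix i
  show "f i = (Some |` dom f) i"
  proof (cases "f i")
    case None
    then show ?thesis by (auto simp: restrict_map_def)
  next
    case (Some j)
    then have "f j = Some j" using fun_cong[OF assms(1), of i] by (simp add: map_comp_def)
    with Some have "i = j" by (intro inj_onD[OF assms(2)]) auto
    then show ?thesis using Some by (simp add: restrict_map_def domI)
  qed
qed

theorem lemma6p8:
  fixes n :: nat
    and A :: "'a set"
    and \<zeta> \<eta> :: 'a
    and R S :: "'a list rel"
    and rep :: "'a \<Rightarrow> (nat \<rightharpoonup> nat)"
  assumes "n \<ge> 4"
    and "\<zeta> \<notin> A" and "\<eta> \<notin> A" and "\<zeta> \<noteq> \<eta>"
    and "presents (Sym n) rep A R"
    and "presents (PT n) rep (A \<union> {\<zeta>, \<eta>}) (R \<union> S)"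
    and "rep \<zeta> \<otimes>\<^bsub>PT n\<^esub> rep \<zeta> = rep \<zeta>" and "dom (rep \<zeta>) = {1..n}"
    and "rank (rep \<zeta>) = n - 1" and "rep \<zeta> 2 = Some 1"
    and "rep \<eta> \<otimes>\<^bsub>PT n\<^esub> rep \<eta> = rep \<eta>" and "inj_on (rep \<eta>) (dom (rep \<eta>))"
    and "rank (rep \<eta>) = n - 1" and "dom (rep \<eta>) = {2..n}"
  shows "\<exists>T. T \<subseteq> relations_of_rank n rep S (n - 2) \<and> card T = 4"
proof -
  interpret sym_extension n A "{\<zeta>, \<eta>}" R S rep
    using assms by unfold_locales auto
  have z: "rep \<zeta> = (\<lambda>i. if i = 2 then Some 1 else if i \<in> {1..n} then Some i else None)"
    using rep_X assms by (intro zeta_eq) (auto simp: mult_PT)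
  have e: "rep \<eta> = (\<lambda>i. if i \<in> {2..n} then Some i else None)"
  proof -
    have "rep \<eta> = Some |` dom (rep \<eta>)"
      using assms(11,12) by (intro eta_eq) (simp_all only: mult_PT)
    also have "\<dots> = (\<lambda>i. if i \<in> {2..n} then Some i else None)"
      unfolding assms(14) by (simp add: restrict_map_def)
    finally show ?thesis .
  qed

  \<comment> \<open>One idempotent of rank \<open>n - 2\<close> for each shape: \<open>f1\<close>
    identifies 1, 2, 3; \<open>f2\<close> identifies 1 with 2 and 3 with 4; \<open>f3\<close>
    identifies 1 with 2 and omits 3; \<open>f4\<close> omits 1 and 2.\<close>
  define f1 where "f1 i = (if i \<in> {1, 2, 3} then Some 1 else if i \<in> {1..n} then Some i else None)" for i
  define f2 where "f2 i = (if i \<in> {1, 2} then Some 1 else if i \<in> {3, 4} then Some 3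
    else if i \<in> {1..n} then Some i else None)" for i
  define f3 where "f3 i = (if i \<in> {1, 2} then Some 1 else if i \<in> {4..n} then Some i else None)" for i
  define f4 where "f4 i = (if i \<in> {3..n} then Some i else None)" for i

  have d1: "dom f1 = {1..n}"
    using assms(1) by (auto simp: f1_def dom_def split: if_splits)
  have r1: "ran f1 = {1..n} - {2, 3}"
    using assms(1) by (intro ran_idem_eqI) (auto simp: f1_def split: if_splits)
  have d2: "dom f2 = {1..n}"
    using assms(1) by (auto simp: f2_def dom_def split: if_splits)
  have r2: "ran f2 = {1..n} - {2, 4}"
    using assms(1) by (intro ran_idem_eqI) (auto simp: f2_def split: if_splits)
  have d3: "dom f3 = {1..n} - {3}"
    using assms(1) by (auto simp: f3_def dom_def split: if_splits)
  have r3: "ran f3 = {1..n} - {2, 3}"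
    using assms(1) by (intro ran_idem_eqI) (auto simp: f3_def split: if_splits)
  have d4: "dom f4 = {1..n} - {1, 2}"
    using assms(1) by (auto simp: f4_def dom_def split: if_splits)
  have r4: "ran f4 = {1..n} - {1, 2}"
    using assms(1) by (intro ran_idem_eqI) (auto simp: f4_def split: if_splits)

  have s1: "shape f1 = (n, True)"
    unfolding shape_def d1
    by (simp, rule exI[of _ 1], rule exI[of _ 2], simp add: f1_def, rule exI[of _ 3], simp)
  have s2: "shape f2 = (n, False)"
    using d2 by (auto simp: shape_def f2_def split: if_splits)
  \<comment> \<open>For \<open>f3\<close> and \<open>f4\<close> the domain size alone sets the shape
    apart.\<close>
  have s3: "fst (shape f3) = n - 1"
    using d3 assms(1) by (simp add: shape_def card_Diff_subset)
  have s4: "fst (shape f4) = n - 2"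
    using d4 assms(1) by (simp add: shape_def card_Diff_subset)

  \<comment> \<open>Precomposing with \<open>p\<close> moves the class \<open>{1, 2}\<close> of
    \<zeta> to \<open>{2, 3}\<close> and the point 1 omitted by \<eta> to 3. Precomposing with
    \<open>q\<close> moves \<open>{1, 2}\<close> to \<open>{3, 4}\<close>.\<close>
  define p where "p = transpose (1 :: nat) 3"
  define q where "q = transpose (1 :: nat) 3 \<circ> transpose 2 4"
  have p: "p permutes {1..n}" "p \<circ> p = id"
    using assms(1) by (auto simp: p_def intro: permutes_swap_id)
  have q: "q permutes {1..n}"
    unfolding q_def using assms(1) by (intro permutes_compose permutes_swap_id) auto
  have qq: "q \<circ> q = id"
    by (auto simp: q_def fun_eq_iff transpose_def)

  \<comment> \<open>The class of three can be begun by identifying 1 with 2 or 2 with 3.\<close>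
  obtain a1 b1 where 1: "(a1, b1) \<in> relations_of_rank n rep S (n - 2)" "shape (val a1) = shape f1"
  proof (rule relation_of_two_factorizations[OF _ _ p, of f1 \<zeta> \<zeta>])
    show "f1 \<in> carrier (PT n)" "rank f1 = n - 2"
      using d1 r1 assms(1) by (auto simp: carrier_PT rank_def card_Diff_subset)
    show "f1 \<circ>\<^sub>m rep \<zeta> = f1" "(f1 \<circ> p) \<circ>\<^sub>m rep \<zeta> = f1 \<circ> p"
      using assms(1) by (auto simp: z f1_def p_def map_comp_def transpose_def fun_eq_iff)
    have "(1, 2) \<in> kern (rep \<zeta>) - kern (rep \<zeta> \<circ> p)"
      using assms(1) by (simp add: kern_def z p_def transpose_def)
    then show "kern (rep \<zeta>) \<noteq> kern (rep \<zeta> \<circ> p)" by blast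
  qed auto
  \<comment> \<open>Either of the two pairs can be identified first.\<close>
  obtain a2 b2 where 2: "(a2, b2) \<in> relations_of_rank n rep S (n - 2)" "shape (val a2) = shape f2"
  proof (rule relation_of_two_factorizations[OF _ _ q qq, of f2 \<zeta> \<zeta>])
    show "f2 \<in> carrier (PT n)" "rank f2 = n - 2"
      using d2 r2 assms(1) by (auto simp: carrier_PT rank_def card_Diff_subset)
    show "f2 \<circ>\<^sub>m rep \<zeta> = f2" "(f2 \<circ> q) \<circ>\<^sub>m rep \<zeta> = f2 \<circ> q"
      using assms(1) by (auto simp: z f2_def q_def map_comp_def transpose_def fun_eq_iff)
    have "(1, 2) \<in> kern (rep \<zeta>) - kern (rep \<zeta> \<circ> q)"
      using assms(1) by (simp add: kern_def z q_def transpose_def)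
    then show "kern (rep \<zeta>) \<noteq> kern (rep \<zeta> \<circ> q)" by blast
  qed auto
  \<comment> \<open>Either 1 and 2 are identified first, or 3 is omitted first.\<close>
  obtain a3 b3 where 3: "(a3, b3) \<in> relations_of_rank n rep S (n - 2)" "shape (val a3) = shape f3"
  proof (rule relation_of_two_factorizations[OF _ _ p, of f3 \<zeta> \<eta>])
    show "f3 \<in> carrier (PT n)" "rank f3 = n - 2"
      using d3 r3 assms(1) by (auto simp: carrier_PT rank_def card_Diff_subset)
    show "f3 \<circ>\<^sub>m rep \<zeta> = f3" "(f3 \<circ> p) \<circ>\<^sub>m rep \<eta> = f3 \<circ> p"
      using assms(1) by (auto simp: z e f3_def p_def map_comp_def transpose_def fun_eq_iff)
    have "(1, 2) \<in> kern (rep \<zeta>) - kern (rep \<eta> \<circ> p)"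
      using assms(1) by (simp add: kern_def z e p_def transpose_def)
    then show "kern (rep \<zeta>) \<noteq> kern (rep \<eta> \<circ> p)" by blast
  qed auto
  \<comment> \<open>The two points to be omitted can be identified first by \<zeta>, or 1 can be
    omitted first by \<eta>.\<close>
  obtain a4 b4 where 4: "(a4, b4) \<in> relations_of_rank n rep S (n - 2)" "shape (val a4) = shape f4"
  proof (rule relation_of_two_factorizations[OF _ _ permutes_id, of f4 \<zeta> \<eta>])
    show "f4 \<in> carrier (PT n)" "rank f4 = n - 2"
      using d4 r4 assms(1) by (auto simp: carrier_PT rank_def card_Diff_subset)
    show "f4 \<circ>\<^sub>m rep \<zeta> = f4" "(f4 \<circ> id) \<circ>\<^sub>m rep \<eta> = f4 \<circ> id"
      using assms(1) by (auto simp: z e f4_def map_comp_def fun_eq_iff)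
    have "(1, 2) \<in> kern (rep \<zeta>) - kern (rep \<eta> \<circ> id)"
      using assms(1) by (simp add: kern_def z e)
    then show "kern (rep \<zeta>) \<noteq> kern (rep \<eta> \<circ> id)" by blast
  qed auto

  \<comment> \<open>The shape of the left side is a function of the relation, so distinct shapes
    give distinct relations.\<close>
  have "distinct [shape f1, shape f2, shape f3, shape f4]"
    using s1 s2 s3 s4 assms(1) by (auto simp: prod_eq_iff)
  then have "distinct (map (\<lambda>(a, b). shape (val a)) [(a1, b1), (a2, b2), (a3, b3), (a4, b4)])"
    using 1 2 3 4 by simp
  then have "distinct [(a1, b1), (a2, b2), (a3, b3), (a4, b4)]"
    by (simp only: distinct_map)
  then have "card (set [(a1, b1), (a2, b2), (a3, b3), (a4, b4)]) = 4"
    by (simp only: distinct_card) simp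
  then show ?thesis
    using 1 2 3 4 by (intro exI[of _ "set [(a1, b1), (a2, b2), (a3, b3), (a4, b4)]"]) simp
qed

end
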